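(* Let $\mathcal V,\mathcal H$ be real Hilbert spaces with norms $\|\cdot\|$ and $|||\cdot|||$, let $\mathcal V'$ be the dual of $\mathcal V$ with norm $\|\cdot\|_*$, and let $b:\mathcal H\times\mathcal V\to\mathbb R$ be a bilinear form with, for positive constants $C_b,\beta$, $$b(p,w)\le C_b|||p|||\,\|w\|\quad\forall p\in\mathcal H,\ w\in\mathcal V,\qquad \inf_{p\in\mathcal H}\sup_{v\in\mathcal V}\frac{b(p,v)}{|||p|||\,\|v\|}\ge\beta .$$ Let $B:\mathcal H\to\mathcal V'$ be defined by $\langle Bp,v\rangle=b(p,v)$ for all $v\in\mathcal V$, and let $Q\subset\mathcal H$ be a finite dimensional subspace. Let $W\subset\mathcal V$ be a finite dimensional subspace with basis $\{e_n\}_{n=1}^N$, $P:\mathcal V\to W$ a bounded linear projector, $W^*=\operatorname{Im}(P^* )$, and $\{\eta_n\}_{n=1}^N$ the basis of $W^*$ with $\langle\eta_n,e_\ell\rangle=\delta_{n,\ell}$. Let $\mathbf S\in\mathbb R^{N\times N}$ be symmetric positive definite and such that $s(v,w)=\vec w^{\,T}\mathbf S\vec v$ satisfies $s(v,w)\le K_\star\|v\|\,\|w\|$ and $s(v,v)\ge\kappa_\star\|v\|^2$ for all $v,w\in W$, with $K_\star,\kappa_\star>0$. Let $\widetilde s(\eta,\zeta)=\vec\eta^{\,T}\mathbf S^{-1}\vec\zeta$ for $\eta,\zeta\in W^*$, and define $$\mathbf c(\eta,\zeta)=\widetilde s(P^*\eta,P^*\zeta),\qquad\eta,\zeta\in\mathcal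 V' .$$ (i) If, for some $c_\star>0$, $\mathbf c(Bq,Bq)\ge c_\star\|Bq\|_*^2$ for all $q\in Q$, then $$\inf_{q\in Q}\sup_{w\in W}\frac{b(q,w)}{|||q|||\,\|w\|}\ge\widehat\beta\qquad\text{with }\widehat\beta=\beta\,(c_\star\kappa_\star)^{1/2}.$$ (ii) Conversely, if $\displaystyle\inf_{q\in Q}\sup_{w\in W}\frac{b(q,w)}{|||q|||\,\|w\|}\ge\widehat\beta$ for some $\widehat\beta>0$, then $\mathbf c(Bq,Bq)\ge c_\star\|Bq\|_*^2$ for all $q\in Q$, with $c_\star$ given by $(c_\star K_\star)^{1/2}=C_b^{-1}\widehat\beta$.
   Context: $\langle\cdot,\cdot\rangle$ is the duality pairing between $\mathcal V'$ and $\mathcal V$, and $\|\eta\|_*=\sup_{v\in\mathcal V,\,v\neq0}\langle\eta,v\rangle/\|v\|$. A projector $P:\mathcal V\to W$ is a linear map onto $W$ with $Pw=w$ for $w\in W$; $P^*:\mathcal V'\to\mathcal V'$ is its adjoint, $\langle P^*\zeta,v\rangle=\langle\zeta,Pv\rangle$, with image $W^*$, which has a basis $\{\eta_n\}_{n=1}^N$ biorthogonal to $\{e_n\}$; moreover $P^*\zeta=\sum_n\langle\zeta,e_n\rangle\eta_n$ for $\zeta\in\mathcal V'$, so the form $\mathbf c$ does not depend on the choice of $P$ (one may take $P$ to be the $\mathcal V$-orthogonal projection onto $W$). For $v=\sum_n v_ne_n\in W$ and $\zeta=\sum_n\zeta_n\eta_n\in W^*$, $\vec v=(v_n)$ and $\vec\zeta=(\zeta_n)$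 denote the coefficient vectors in $\mathbb R^N$. Infima and suprema of quotients are taken over nonzero elements. *)

theory Defs
  imports "HOL-Analysis.Analysis"
begin

text \<open>
  The dual of a real normed space \<open>'v\<close> is the type \<open>'v \<Rightarrow>\<^sub>L real\<close>, with application as the duality
  pairing. Its library norm, an operator norm defined with absolute values, is the dual norm:
\<close>

lemma dual_norm_eq:
  fixes \<zeta> :: "'v::real_normed_vector \<Rightarrow>\<^sub>L real"
  assumes "\<exists>v::'v. v \<noteq> 0"
  shows "norm \<zeta> = (SUP v\<in>UNIV - {0}. \<zeta> v / norm v)"
proof -
  have le: "\<zeta> v / norm v \<le> norm \<zeta>" if "v \<in> UNIV - {0}" for v
  proof -
    have "\<zeta> v \<le> norm \<zeta> * norm v"
      using norm_blinfun[of \<zeta> v] by (simp add: abs_le_iff)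
    then show ?thesis using that by (simp add: divide_le_eq)
  qed
  then have bdd: "bdd_above ((\<lambda>v. \<zeta> v / norm v) ` (UNIV - {0}))"
    by (intro bdd_aboveI2)
  have ne: "UNIV - {0::'v} \<noteq> {}" using assms by auto
  let ?s = "SUP v\<in>UNIV - {0}. \<zeta> v / norm v"
  have up: "\<zeta> v / norm v \<le> ?s" if "v \<noteq> 0" for v
    using bdd that by (intro cSUP_upper) auto
  obtain v0 :: 'v where v0: "v0 \<noteq> 0" using assms by blast
  have "0 \<le> ?s"
    using up[OF v0] up[of "- v0"] v0 by (simp add: blinfun.minus_right)
  moreover have "norm (\<zeta> v) \<le> ?s * norm v" for v
  proof (cases "v = 0")
    case False
    then have pos: "0 < norm v" by simp
    have "\<zeta> v / norm v \<le> ?s" "(- \<zeta> v) / norm v \<le> ?s"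
      using up[of v] up[of "- v"] False by (simp_all add: blinfun.minus_right)
    then have "\<zeta> v \<le> ?s * norm v" "- \<zeta> v \<le> ?s * norm v"
      by (simp_all only: pos_divide_le_eq[OF pos])
    then show ?thesis by (simp add: abs_le_iff)
  qed simp
  ultimately have "norm \<zeta> \<le> ?s" by (rule norm_blinfun_bound)
  moreover have "?s \<le> norm \<zeta>" using ne le by (intro cSUP_least) auto
  ultimately show ?thesis by simp
qed

definition finite_dim_subspace :: "'a::real_vector set \<Rightarrow> bool" where
  "finite_dim_subspace U \<longleftrightarrow> subspace U \<and> (\<exists>A. finite A \<and> span A = U)"

definition family_basis :: "('n::finite \<Rightarrow> 'a::real_vector) \<Rightarrow> 'a set \<Rightarrow> bool" where
  "family_basis e U \<longleftrightarrow> inj e \<and> independent (range e) \<and> span (range e) = U"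

definition coeffs :: "('n::finite \<Rightarrow> 'a::real_vector) \<Rightarrow> 'a \<Rightarrow> real ^ 'n" where
  "coeffs e v = (\<chi> n. representation (range e) v (e n))"

lemma coeffs_expansion:
  assumes "family_basis e U" "v \<in> U"
  shows "v = (\<Sum>n\<in>UNIV. coeffs e v $ n *\<^sub>R e n)"
proof -
  have inj: "inj e" and ind: "independent (range e)" and v: "v \<in> span (range e)"
    using assms by (auto simp: family_basis_def)
  have "(\<Sum>x\<in>range e. representation (range e) v x *\<^sub>R x) = v"
    by (rule real_vector.sum_representation_eq[OF ind v]) auto
  then show ?thesis
    by (simp add: coeffs_def sum.reindex[OF inj] o_def)
qed

text \<open>
  The infimum and supremum are over nonzero elements. In the extended reals an infimum over
  the empty set is \<open>\<infinity>\<close> (the lower bound is void on the zero space), and no boundedness side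
  conditions arise.
\<close>

definition inf_sup :: "('h::real_normed_vector \<Rightarrow> 'v::real_normed_vector \<Rightarrow> real)
    \<Rightarrow> 'h set \<Rightarrow> 'v set \<Rightarrow> ereal" where
  "inf_sup b X Y = (INF p\<in>X - {0}. SUP v\<in>Y - {0}. ereal (b p v / (norm p * norm v)))"

definition projector_onto :: "('v::real_normed_vector \<Rightarrow>\<^sub>L 'v) \<Rightarrow> 'v set \<Rightarrow> bool" where
  "projector_onto P W \<longleftrightarrow> range (blinfun_apply P) = W \<and> (\<forall>w\<in>W. P w = w)"

definition dual_adjoint :: "('v::real_normed_vector \<Rightarrow>\<^sub>L 'v)
    \<Rightarrow> ('v \<Rightarrow>\<^sub>L real) \<Rightarrow> ('v \<Rightarrow>\<^sub>L real)" where
  "dual_adjoint P \<zeta> = \<zeta> o\<^sub>L P"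

definition sym_pos_def :: "real ^ 'n ^ 'n \<Rightarrow> bool" where
  "sym_pos_def S \<longleftrightarrow> transpose S = S \<and> (\<forall>x. x \<noteq> 0 \<longrightarrow> 0 < x \<bullet> (S *v x))"

definition s_form :: "real ^ 'n ^ 'n \<Rightarrow> ('n::finite \<Rightarrow> 'v::real_vector) \<Rightarrow> 'v \<Rightarrow> 'v \<Rightarrow> real" where
  "s_form S e v w = coeffs e w \<bullet> (S *v coeffs e v)"

definition s_tilde :: "real ^ 'n ^ 'n \<Rightarrow> ('n::finite \<Rightarrow> 'v::real_normed_vector \<Rightarrow>\<^sub>L real)
    \<Rightarrow> ('v \<Rightarrow>\<^sub>L real) \<Rightarrow> ('v \<Rightarrow>\<^sub>L real) \<Rightarrow> real" where
  "s_tilde S \<eta> \<xi> \<zeta> = coeffs \<eta> \<xi> \<bullet> (matrix_inv S *v coeffs \<eta> \<zeta>)"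

definition c_form :: "real ^ 'n ^ 'n \<Rightarrow> ('n::finite \<Rightarrow> 'v::real_normed_vector \<Rightarrow>\<^sub>L real)
    \<Rightarrow> ('v \<Rightarrow>\<^sub>L 'v) \<Rightarrow> ('v \<Rightarrow>\<^sub>L real) \<Rightarrow> ('v \<Rightarrow>\<^sub>L real) \<Rightarrow> real" where
  "c_form S \<eta> P \<xi> \<zeta> = s_tilde S \<eta> (dual_adjoint P \<xi>) (dual_adjoint P \<zeta>)"

end

theory Submission
  imports Defs
begin

text \<open>
  Let \<open>g\<close> be the vector with entries \<open>g\<^sub>n = \<langle>\<xi>, e\<^sub>n\<rangle>\<close>. Then \<open>c(\<xi>, \<xi>) = g \<bullet> S\<^sup>-\<^sup>1 g\<close>, and \<open>\<xi>\<close> restricted to \<open>W\<close>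
  is represented in the inner product \<open>s\<close> by the element \<open>z\<close> of \<open>W\<close> with coefficients \<open>S\<^sup>-\<^sup>1 g\<close>, so
  that \<open>c(\<xi>, \<xi>) = \<langle>\<xi>, z\<rangle> = s(z, z)\<close>. For (i), test \<open>b(q, \<cdot>) = \<langle>Bq, \<cdot>\<rangle>\<close> with \<open>z\<close>; for (ii), apply the
  Cauchy-Schwarz inequality for \<open>s\<close> to \<open>\<langle>Bq, w\<rangle> = s(z, w)\<close>.
\<close>

text \<open>Each quotient at \<open>p\<close> is at most \<open>M / norm p\<close>, hence so is
  their supremum. This turns an inf-sup condition into a bound on \<open>norm p\<close>. If
  \<open>Y\<close> has no nonzero element, the supremum is minus infinity and the same estimate
  applies.\<close>

lemma inf_sup_ge_bound:
  assumes "ereal r \<le> inf_sup b X Y" "p \<in> X" "p \<noteq> 0"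
    and bound: "\<And>v. v \<in> Y \<Longrightarrow> b p v \<le> M * norm v"
  shows "r * norm p \<le> M"
proof -
  have pos: "0 < norm p" using assms(3) by simp
  have "ereal r \<le> (SUP v\<in>Y - {0}. ereal (b p v / (norm p * norm v)))"
    using assms(1-3) unfolding inf_sup_def by (auto simp: le_INF_iff)
  also have "\<dots> \<le> ereal (M / norm p)"
  proof (rule SUP_least)
    fix v assume v: "v \<in> Y - {0}"
    then show "ereal (b p v / (norm p * norm v)) \<le> ereal (M / norm p)"
      using bound[of v] pos by (simp add: field_simps)
  qed
  finally show ?thesis using pos by (simp add: field_simps)
qed

text \<open>The supremum dominates the quotient of any single element, so one good test element per
  \<open>p\<close> suffices.\<close>

lemma inf_sup_geI:
  assumes "\<And>p. p \<in> X \<Longrightarrow> p \<noteq> 0 \<Longrightarrow> \<exists>v\<in>Y. v \<noteq> 0 \<and> r * norm p * norm v \<le> b p v"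
  shows "ereal r \<le> inf_sup b X Y"
  unfolding inf_sup_def
proof (rule INF_greatest)
  fix p assume p: "p \<in> X - {0}"
  then obtain v where v: "v \<in> Y" "v \<noteq> 0" "r * norm p * norm v \<le> b p v"
    using assms by blast
  have "r \<le> b p v / (norm p * norm v)"
    using p v by (simp add: pos_le_divide_eq mult.assoc)
  then show "ereal r \<le> (SUP v\<in>Y - {0}. ereal (b p v / (norm p * norm v)))"
    using v by (intro SUP_upper2[of v]) auto
qed

lemma sym_pos_def_nonneg:
  "sym_pos_def S \<Longrightarrow> 0 \<le> x \<bullet> (S *v x)" for S :: "real ^ 'n ^ 'n"
  by (cases "x = 0") (auto simp: sym_pos_def_def less_imp_le)

lemma sym_pos_def_commute:
  "sym_pos_def S \<Longrightarrow> x \<bullet> (S *v y) = y \<bullet> (S *v x)" for S :: "real ^ 'n ^ 'n"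
  by (metis dot_lmul_matrix inner_commute sym_pos_def_def transpose_matrix_vector)

text \<open>Positive definiteness makes the kernel of \<open>S\<close> trivial, so an inverse exists
  and the choice inside \<open>matrix_inv\<close> picks one.\<close>

lemma sym_pos_def_matrix_inv:
  fixes S :: "real ^ 'n ^ 'n"
  assumes "sym_pos_def S"
  shows "S *v (matrix_inv S *v x) = x"
proof -
  have "x = 0" if "S *v x = 0" for x
    using assms that unfolding sym_pos_def_def by (metis inner_zero_right less_irrefl)
  then have "invertible S"
    by (simp add: invertible_left_inverse matrix_left_invertible_ker)
  then have "S ** matrix_inv S = mat 1"
    unfolding invertible_def matrix_inv_def by (rule someI2_ex) simp
  then show ?thesis
    by (simp add: matrix_vector_mul_assoc)
qed

lemma sym_pos_def_Cauchy_Schwarz: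
  fixes S :: "real ^ 'n ^ 'n"
  assumes S: "sym_pos_def S"
  shows "(x \<bullet> (S *v y))\<^sup>2 \<le> (x \<bullet> (S *v x)) * (y \<bullet> (S *v y))"
proof (cases "x = 0")
  case False
  then have pos: "0 < x \<bullet> (S *v x)" using S by (simp add: sym_pos_def_def)
  \<comment> \<open>This \<open>t\<close> minimizes the quadratic form of \<open>S\<close> at
    \<open>y - t *\<^sub>R x\<close>; its nonnegative minimum value gives the inequality.\<close>
  define t where "t = x \<bullet> (S *v y) / (x \<bullet> (S *v x))"
  have "0 \<le> (y - t *\<^sub>R x) \<bullet> (S *v (y - t *\<^sub>R x))"
    by (rule sym_pos_def_nonneg[OF S])
  also have "\<dots> = y \<bullet> (S *v y) - 2 * t * (x \<bullet> (S *v y)) + t\<^sup>2 * (x \<bullet> (S *v x))"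
    using sym_pos_def_commute[OF S, of y x]
    by (simp add: matrix_vector_mult_diff_distrib matrix_vector_mult_scaleR inner_diff_left
        inner_diff_right power2_eq_square algebra_simps)
  also have "\<dots> = y \<bullet> (S *v y) - (x \<bullet> (S *v y))\<^sup>2 / (x \<bullet> (S *v x))"
    using pos by (simp add: t_def power2_eq_square field_simps)
  finally show ?thesis using pos by (simp add: field_simps)
qed simp

lemma biorthogonal_sum:
  fixes e :: "'n::finite \<Rightarrow> 'v::real_normed_vector" and \<eta> :: "'n \<Rightarrow> 'v \<Rightarrow>\<^sub>L real"
  assumes "\<And>n l. \<eta> n (e l) = (if n = l then 1 else 0)"
  shows "\<eta> n (\<Sum>l\<in>UNIV. x l *\<^sub>R e l) = x n"
    and "(\<Sum>l\<in>UNIV. x l *\<^sub>R \<eta> l) (e n) = x n"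
  by (simp_all add: blinfun.bilinear_simps assms if_distrib if_distribR cong: if_cong)

text \<open>Pairing a basis expansion with the dual family leaves one term, so coefficients in
  either basis are values of the pairing.\<close>

lemma coeffs_biorthogonal:
  fixes e :: "'n::finite \<Rightarrow> 'v::real_normed_vector" and \<eta> :: "'n \<Rightarrow> 'v \<Rightarrow>\<^sub>L real"
  assumes "\<And>n l. \<eta> n (e l) = (if n = l then 1 else 0)"
  shows "family_basis e U \<Longrightarrow> v \<in> U \<Longrightarrow> coeffs e v = (\<chi> n. \<eta> n v)"
    and "family_basis \<eta> U' \<Longrightarrow> \<xi> \<in> U' \<Longrightarrow> coeffs \<eta> \<xi> = (\<chi> n. \<xi> (e n))"
proof -
  show "coeffs e v = (\<chi> n. \<eta> n v)" if "family_basis e U" "v \<in> U"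
    using biorthogonal_sum(1)[of \<eta> e, OF assms, of _ "($) (coeffs e v)"]
    by (simp add: vec_eq_iff flip: coeffs_expansion[OF that])
  show "coeffs \<eta> \<xi> = (\<chi> n. \<xi> (e n))" if "family_basis \<eta> U'" "\<xi> \<in> U'"
    using biorthogonal_sum(2)[of \<eta> e, OF assms, of "($) (coeffs \<eta> \<xi>)"]
    by (simp add: vec_eq_iff flip: coeffs_expansion[OF that])
qed

lemma c_form_Riesz:
  fixes e :: "'n::finite \<Rightarrow> 'v::real_normed_vector" and \<eta> :: "'n \<Rightarrow> 'v \<Rightarrow>\<^sub>L real"
  assumes e: "family_basis e W" and P: "projector_onto P W"
    and \<eta>: "family_basis \<eta> (range (dual_adjoint P))"
    and bi: "\<And>n l. \<eta> n (e l) = (if n = l then 1 else 0)"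
    and S: "sym_pos_def S"
  obtains z where "z \<in> W" "c_form S \<eta> P \<xi> \<xi> = \<xi> z" "s_form S e z z = \<xi> z"
    "\<And>w. w \<in> W \<Longrightarrow> s_form S e w z = \<xi> w"
proof -
  define g :: "real ^ 'n" where "g = (\<chi> n. \<xi> (e n))"
  define y where "y = matrix_inv S *v g"
  define z where "z = (\<Sum>l\<in>UNIV. y $ l *\<^sub>R e l)"
  have Sy: "S *v y = g"
    unfolding y_def by (rule sym_pos_def_matrix_inv[OF S])
  have e_W: "e n \<in> W" for n
    using e by (auto simp: family_basis_def intro: span_base)
  have zW: "z \<in> W"
    using e unfolding z_def family_basis_def by (blast intro: span_sum span_scale span_base)
  have coeffs_z: "coeffs e z = y"
    using coeffs_biorthogonal(1)[OF bi e zW] biorthogonal_sum(1)[OF bi]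
    by (simp add: z_def vec_eq_iff)
  \<comment> \<open>\<open>P\<close> fixes each \<open>e n\<close>, so
    \<open>dual_adjoint P \<xi>\<close> and \<open>\<xi>\<close> agree on the basis of
    \<open>W\<close>.\<close>
  have "coeffs \<eta> (dual_adjoint P \<xi>) = g"
    using coeffs_biorthogonal(2)[OF bi \<eta>, of "dual_adjoint P \<xi>"] P e_W
    by (simp add: g_def dual_adjoint_def projector_onto_def)
  then have c: "c_form S \<eta> P \<xi> \<xi> = g \<bullet> y"
    by (simp add: c_form_def s_tilde_def y_def)
  have eval: "\<xi> w = g \<bullet> coeffs e w" if "w \<in> W" for w
    by (subst coeffs_expansion[OF e that])
      (simp add: blinfun.bilinear_simps inner_vec_def g_def mult.commute)
  \<comment> \<open>Symmetry moves \<open>S\<close> onto \<open>y\<close>, where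
    \<open>S *v y = g\<close>.\<close>
  have rep: "s_form S e w z = \<xi> w" if "w \<in> W" for w
    using eval[OF that] sym_pos_def_commute[OF S, of y] Sy
    by (simp add: s_form_def coeffs_z inner_commute)
  show ?thesis
    using that[OF zW _ rep[OF zW] rep] eval[OF zW] c coeffs_z by simp
qed

theorem corollary5p3:
  fixes b :: "'h::{real_inner, complete_space} \<Rightarrow> 'v::{real_inner, complete_space} \<Rightarrow> real"
    and B :: "'h \<Rightarrow> ('v \<Rightarrow>\<^sub>L real)"
    and C\<^sub>b \<beta> K \<kappa> :: real
    and Q :: "'h set" and W :: "'v set"
    and e :: "'n::finite \<Rightarrow> 'v" and \<eta> :: "'n \<Rightarrow> ('v \<Rightarrow>\<^sub>L real)"
    and P :: "'v \<Rightarrow>\<^sub>L 'v" and S :: "real ^ 'n ^ 'n"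
  assumes "bilinear b"
    and "C\<^sub>b > 0" and "\<beta> > 0"
    and "\<And>p w. b p w \<le> C\<^sub>b * norm p * norm w"
    and "inf_sup b UNIV UNIV \<ge> ereal \<beta>"
    and "\<And>p v. blinfun_apply (B p) v = b p v"
    and "finite_dim_subspace Q"
    and "finite_dim_subspace W" and "family_basis e W"
    and "projector_onto P W"
    and "family_basis \<eta> (range (dual_adjoint P))"
    and "\<And>n l. blinfun_apply (\<eta> n) (e l) = (if n = l then 1 else 0)"
    and "sym_pos_def S"
    and "K > 0" and "\<kappa> > 0"
    and "\<And>v w. v \<in> W \<Longrightarrow> w \<in> W \<Longrightarrow> s_form S e v w \<le> K * norm v * norm w"
    and "\<And>v. v \<in> W \<Longrightarrow> s_form S e v v \<ge> \<kappa> * (norm v)\<^sup>2"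
  shows "(\<forall>c>0. (\<forall>q\<in>Q. c_form S \<eta> P (B q) (B q) \<ge> c * (norm (B q))\<^sup>2)
            \<longrightarrow> inf_sup b Q W \<ge> ereal (\<beta> * sqrt (c * \<kappa>)))
       \<and> (\<forall>\<beta>'>0. inf_sup b Q W \<ge> ereal \<beta>'
            \<longrightarrow> (\<exists>c>0. sqrt (c * K) = inverse C\<^sub>b * \<beta>'
                  \<and> (\<forall>q\<in>Q. c_form S \<eta> P (B q) (B q) \<ge> c * (norm (B q))\<^sup>2)))"
proof (intro conjI allI impI)
  note \<beta> = assms(3) and B = assms(6) and \<kappa> = assms(15)
  note Riesz = c_form_Riesz[OF assms(9-13)]

  fix c :: real
  assume c: "0 < c" and coercive: "\<forall>q\<in>Q. c * (norm (B q))\<^sup>2 \<le> c_form S \<eta> P (B q) (B q)"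
  show "ereal (\<beta> * sqrt (c * \<kappa>)) \<le> inf_sup b Q W"
  proof (rule inf_sup_geI)
    fix q assume q: "q \<in> Q" "q \<noteq> 0"
    obtain z where z: "z \<in> W" "c_form S \<eta> P (B q) (B q) = B q z" "s_form S e z z = B q z"
      using Riesz[of "B q"] by metis
    \<comment> \<open>The inf-sup condition on the whole spaces bounds \<open>B\<close> from below,
      since \<open>b q v\<close> is at most \<open>norm (B q) * norm v\<close>.\<close>
    have "\<beta> * norm q \<le> norm (B q)"
      using norm_blinfun[of "B q"] q
      by (intro inf_sup_ge_bound[OF assms(5)]) (auto simp: B abs_le_iff)
    then have "c * (\<beta> * norm q)\<^sup>2 \<le> c * (norm (B q))\<^sup>2"
      using c \<beta> by (intro mult_left_mono power_mono) auto
    then have lower: "c * (\<beta> * norm q)\<^sup>2 \<le> b q z"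
      using coercive q(1) z(2) B by force
    have upper: "\<kappa> * (norm z)\<^sup>2 \<le> b q z"
      using assms(17)[OF z(1)] z(3) B by simp
    have pos: "0 < b q z"
      using lower c \<beta> q by (smt (verit) mult_pos_pos zero_less_norm_iff zero_less_power)
    \<comment> \<open>The value \<open>b q z\<close> dominates both factors on the right, hence also
      their geometric mean, which is linear in \<open>norm q\<close> and
      \<open>norm z\<close>.\<close>
    have "(\<beta> * sqrt (c * \<kappa>) * norm q * norm z)\<^sup>2 = (c * (\<beta> * norm q)\<^sup>2) * (\<kappa> * (norm z)\<^sup>2)"
      using c \<kappa> by (simp add: power_mult_distrib algebra_simps)
    also have "\<dots> \<le> (b q z)\<^sup>2"
      unfolding power2_eq_square[of "b q z"] using lower upper c \<kappa> pos
      by (intro mult_mono) auto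
    finally have "\<beta> * sqrt (c * \<kappa>) * norm q * norm z \<le> b q z"
      by (rule power2_le_imp_le) (use pos in simp)
    moreover have "z \<noteq> 0"
      using pos by (auto simp flip: B)
    ultimately show "\<exists>w\<in>W. w \<noteq> 0 \<and> \<beta> * sqrt (c * \<kappa>) * norm q * norm w \<le> b q w"
      using z(1) by blast
  qed
next
  note C = assms(2) and b_le = assms(4) and B = assms(6) and S = assms(13) and K = assms(14)
  note Riesz = c_form_Riesz[OF assms(9-13)]

  fix \<beta>' :: real
  assume \<beta>': "0 < \<beta>'" and inf_sup: "ereal \<beta>' \<le> inf_sup b Q W"
  \<comment> \<open>The value obtained by solving the required identity for
    \<open>c\<close>.\<close>
  define c where "c = (inverse C\<^sub>b * \<beta>')\<^sup>2 / K"
  have c: "0 < c" using C \<beta>' K by (simp add: c_def)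
  have "c * (norm (B q))\<^sup>2 \<le> c_form S \<eta> P (B q) (B q)" if q: "q \<in> Q" for q
  proof -
    obtain z where z: "z \<in> W" "c_form S \<eta> P (B q) (B q) = B q z" "s_form S e z z = B q z"
      and rep: "\<And>w. w \<in> W \<Longrightarrow> s_form S e w z = B q w"
      using Riesz[of "B q"] by metis
    have nonneg: "0 \<le> B q z"
      using sym_pos_def_nonneg[OF S] by (simp flip: z(3) add: s_form_def)
    \<comment> \<open>Cauchy-Schwarz for \<open>s_form\<close> and its upper bound \<open>K\<close>
      control the norm of \<open>B q\<close> restricted to \<open>W\<close> by the square root of
      \<open>K\<close> times the value of \<open>c_form\<close>.\<close>
    have dual_bound: "b q w \<le> sqrt (K * B q z) * norm w" if w: "w \<in> W" for w
    proof -
      have "(b q w)\<^sup>2 \<le> s_form S e z z * s_form S e w w"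
        using sym_pos_def_Cauchy_Schwarz[OF S, of "coeffs e z" "coeffs e w"] rep[OF w]
        by (simp add: s_form_def B)
      also have "\<dots> \<le> B q z * (K * norm w * norm w)"
        unfolding z(3) using assms(16)[OF w w] nonneg by (intro mult_left_mono)
      also have "\<dots> = (sqrt (K * B q z) * norm w)\<^sup>2"
        using nonneg K by (simp add: power_mult_distrib power2_eq_square)
      finally show ?thesis
        by (rule power2_le_imp_le) (use nonneg K in simp)
    qed
    \<comment> \<open>The infimum skips \<open>q = 0\<close>, where the left side vanishes.\<close>
    have "\<beta>' * norm q \<le> sqrt (K * B q z)"
    proof (cases "q = 0")
      case False
      with q show ?thesis by (intro inf_sup_ge_bound[OF inf_sup] dual_bound)
    qed (use nonneg K in simp)
    then have "(\<beta>' * norm q)\<^sup>2 \<le> (sqrt (K * B q z))\<^sup>2"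
      using \<beta>' by (intro power_mono) auto
    then have infsup_sq: "(\<beta>' * norm q)\<^sup>2 \<le> K * B q z"
      using nonneg K by simp
    \<comment> \<open>The bound on \<open>b\<close> is one-sided; using it at \<open>v\<close> and
      \<open>- v\<close> gives the absolute value needed for the operator norm.\<close>
    have "norm (B q) \<le> C\<^sub>b * norm q"
    proof (rule norm_blinfun_bound)
      show "norm (B q v) \<le> C\<^sub>b * norm q * norm v" for v
        using b_le[of q v] b_le[of q "- v"] by (simp add: abs_le_iff blinfun.minus_right flip: B)
    qed (use C in simp)
    then have "c * (norm (B q))\<^sup>2 \<le> c * (C\<^sub>b * norm q)\<^sup>2"
      using c by (intro mult_left_mono power_mono) auto
    \<comment> \<open>The factor \<open>C\<^sub>b\<close> cancels against its inverse in
      \<open>c\<close>.\<close>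
    also have "\<dots> = (\<beta>' * norm q)\<^sup>2 / K"
      using C by (simp add: c_def power_mult_distrib field_simps)
    also have "\<dots> \<le> B q z"
      using infsup_sq K by (simp add: divide_le_eq mult.commute)
    finally show ?thesis by (simp add: z(2))
  qed
  moreover have "sqrt (c * K) = inverse C\<^sub>b * \<beta>'"
    using C \<beta>' K by (simp add: c_def)
  ultimately show "\<exists>c>0. sqrt (c * K) = inverse C\<^sub>b * \<beta>' \<and>
      (\<forall>q\<in>Q. c * (norm (B q))\<^sup>2 \<le> c_form S \<eta> P (B q) (B q))"
    using c by blast
qed

end
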